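(* Let $n\ge 1$ be an integer. The tropical polynomial $f=\min_{0\le k\le n}\{x_k+kY\}$ in the variable $Y$ with parametric coefficients $(x_0,\dots,x_n)$ has exactly $n$ tropical zeroes $g_1,\dots,g_n$ that are tropical Newton-Puiseux polynomials in $(x_0,\dots,x_n)$. Moreover, for each $1\le k\le n$ one can represent $g_k$ as follows. For every $0\le p<k$ consider the tropical Newton-Puiseux polynomial $$t_p:=\max_{k\le q\le n}\left\{\frac{x_p-x_q}{q-p}\right\}.$$ Then $g_k=\min_{0\le p<k}\{t_p\}$.
   Context: For a fixed point $(x_0,\dots,x_n)\in\mathbb{R}^{n+1}$, a real number $y$ is a tropical zero of the tropical univariate polynomial $f=\min_{0\le k\le n}\{x_k+kY\}$ if the minimum $\min_{0\le k\le n}\{x_k+ky\}$ is attained for at least two different values of $k\in\{0,\dots,n\}$. A tropical Newton-Puiseux polynomial in the variables $X=(x_0,\dots,x_n)$ is a (continuous) piece-wise linear function $\mathbb{R}^{n+1}\to\mathbb{R}$ with rational coefficients at the variables, i.e. a function that can be represented in the form $$\min_I\{a_I+(I,X)\}-\min_J\{b_J+(J,X)\},$$ where $I$ and $J$ range over finite non-empty subsets of $\mathbb{Q}^{n+1}$, $a_I,b_J\in\mathbb{R}$, and $(I,X)$ denotes the inner product. A tropical Newton-Puiseux polynomial $g=g(x_0,\dots,x_n)$ is called a (tropical) zero of the polynomial $f$ with parametric coefficients if for every $(x_0,\dots,x_n)\in\mathbb{R}^{n+1}$ the value $y=g(x_0,\dots,x_n)$ is a tropical zero of the tropical polynomial $\min_{0\le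 k\le n}\{x_k+kY\}$. Zeroes are counted as functions on $\mathbb{R}^{n+1}$, without multiplicity (so "exactly $n$" means exactly $n$ pairwise distinct functions). *)

theory Defs
  imports Complex_Main "HOL-Library.FuncSet"
begin

text \<open>
  The point \<open>(x\<^sub>0, \<dots>, x\<^sub>n)\<close> is encoded as an extensional function on \<open>{..n}\<close>
  (\<open>undefined\<close> outside), and real functions on the space are extensional as well. Hence
  HOL equality is equality of points and of functions on the space, so that counting
  zeroes with \<open>card\<close> is meaningful.
\<close>

definition coord_space :: "nat \<Rightarrow> (nat \<Rightarrow> real) set" where
  "coord_space n = ({..n} \<rightarrow>\<^sub>E UNIV)"

definition inner_upto :: "nat \<Rightarrow> (nat \<Rightarrow> real) \<Rightarrow> (nat \<Rightarrow> real) \<Rightarrow> real" where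
  "inner_upto n u x = (\<Sum>i\<le>n. u i * x i)"

definition trop_poly :: "nat \<Rightarrow> (nat \<Rightarrow> real) \<Rightarrow> real \<Rightarrow> real" where
  "trop_poly n x y = (MIN k\<in>{..n}. x k + real k * y)"

definition is_trop_zero :: "nat \<Rightarrow> (nat \<Rightarrow> real) \<Rightarrow> real \<Rightarrow> bool" where
  "is_trop_zero n x y \<longleftrightarrow>
     (\<exists>j\<le>n. \<exists>k\<le>n. j \<noteq> k \<and>
        x j + real j * y = trop_poly n x y \<and> x k + real k * y = trop_poly n x y)"

text \<open>The variables are \<open>x\<^sub>0, \<dots>, x\<^sub>n\<close>; \<open>\<rat>\<close> below is the set of rational real numbers.\<close>

definition trop_newton_puiseux :: "nat \<Rightarrow> ((nat \<Rightarrow> real) \<Rightarrow> real) \<Rightarrow> bool" where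
  "trop_newton_puiseux n g \<longleftrightarrow>
     g \<in> coord_space n \<rightarrow>\<^sub>E UNIV \<and>
     (\<exists>\<I> \<J> a b.
        finite \<I> \<and> \<I> \<noteq> {} \<and> \<I> \<subseteq> ({..n} \<rightarrow>\<^sub>E \<rat>) \<and>
        finite \<J> \<and> \<J> \<noteq> {} \<and> \<J> \<subseteq> ({..n} \<rightarrow>\<^sub>E \<rat>) \<and>
        (\<forall>x\<in>coord_space n.
           g x = (MIN I\<in>\<I>. a I + inner_upto n I x) - (MIN J\<in>\<J>. b J + inner_upto n J x)))"

definition parametric_zeroes :: "nat \<Rightarrow> ((nat \<Rightarrow> real) \<Rightarrow> real) set" where
  "parametric_zeroes n =
     {g. trop_newton_puiseux n g \<and> (\<forall>x\<in>coord_space n. is_trop_zero n x (g x))}"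

text \<open>The function \<open>t\<^sub>p\<close> depends on \<open>k\<close> through the range of \<open>q\<close>.\<close>

definition zero_term :: "nat \<Rightarrow> nat \<Rightarrow> nat \<Rightarrow> (nat \<Rightarrow> real) \<Rightarrow> real" where
  "zero_term n k p = (\<lambda>x\<in>coord_space n. MAX q\<in>{k..n}. (x p - x q) / (real q - real p))"

end

theory Submission
  imports Defs "HOL-Analysis.Analysis"
begin

text \<open>
  A point \<open>y\<close> is a zero iff, for some \<open>1 \<le> k \<le> n\<close>, the minimum of the \<open>x\<^sub>j + j y\<close> is attained both
  at an index below \<open>k\<close> and at one not below \<open>k\<close>; for given \<open>k\<close> this happens exactly at
  \<open>y = min\<^sub>p max\<^sub>q (x\<^sub>p - x\<^sub>q) / (q - p)\<close>, the negated slope over \<open>[k - 1, k]\<close> of the lower convex hull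
  of the points \<open>(j, x\<^sub>j)\<close>. So these \<open>n\<close> functions are zeroes. That there are no others uses only that a
  zero \<open>g\<close> is continuous along segments. At strictly convex \<open>x\<close> the \<open>n\<close> values are distinct, so on the
  segment from the point with \<open>x\<^sub>j = j\<^sup>2\<close> to the lower hull of an arbitrary \<open>x\<close> the index \<open>k\<close> selected by \<open>g\<close>
  cannot change. On the segment from the hull to \<open>x\<close> itself all \<open>n\<close> values are constant, so \<open>g\<close> is too.
\<close>

section \<open>Tropical Newton-Puiseux polynomials\<close>

text \<open>Unlike in \<^const>\<open>trop_newton_puiseux\<close>, an exponent may occur here with several coefficients,
  which makes sums easy to represent.\<close>

definition trop_polynomial :: "nat \<Rightarrow> ((nat \<Rightarrow> real) \<Rightarrow> real) \<Rightarrow> bool" where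
  "trop_polynomial n A \<longleftrightarrow>
     (\<exists>P. finite P \<and> P \<noteq> {} \<and> snd ` P \<subseteq> ({..n} \<rightarrow>\<^sub>E \<rat>) \<and>
        (\<forall>x\<in>coord_space n. A x = (MIN t\<in>P. fst t + inner_upto n (snd t) x)))"

text \<open>No extensionality is demanded, so the closure properties below can be stated for plain
  functions; \<open>trop_newton_puiseux_restrict\<close> cuts down to the space once at the
  end.\<close>

definition trop_rational :: "nat \<Rightarrow> ((nat \<Rightarrow> real) \<Rightarrow> real) \<Rightarrow> bool" where
  "trop_rational n g \<longleftrightarrow>
     (\<exists>A B. trop_polynomial n A \<and> trop_polynomial n B \<and> (\<forall>x\<in>coord_space n. g x = A x - B x))"

lemma trop_polynomial_inner:
  assumes "I \<in> {..n} \<rightarrow>\<^sub>E \<rat>"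
  shows "trop_polynomial n (inner_upto n I)"
  unfolding trop_polynomial_def using assms by (intro exI[of _ "{(0, I)}"]) auto

lemma trop_polynomial_min:
  assumes "trop_polynomial n A" "trop_polynomial n B"
  shows "trop_polynomial n (\<lambda>x. min (A x) (B x))"
proof -
  obtain P where P: "finite P" "P \<noteq> {}" "snd ` P \<subseteq> ({..n} \<rightarrow>\<^sub>E \<rat>)"
      "\<And>x. x \<in> coord_space n \<Longrightarrow> A x = (MIN t\<in>P. fst t + inner_upto n (snd t) x)"
    using assms(1) unfolding trop_polynomial_def by blast
  obtain Q where Q: "finite Q" "Q \<noteq> {}" "snd ` Q \<subseteq> ({..n} \<rightarrow>\<^sub>E \<rat>)"
      "\<And>x. x \<in> coord_space n \<Longrightarrow> B x = (MIN t\<in>Q. fst t + inner_upto n (snd t) x)"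
    using assms(2) unfolding trop_polynomial_def by blast
  show ?thesis
    unfolding trop_polynomial_def
    by (rule exI[of _ "P \<union> Q"]) (use P Q in \<open>auto simp: image_Un Min_Un\<close>)
qed

text \<open>A sum of two minima is the minimum over all pairs of terms. Different pairs may yield
  the same exponent with different coefficients.\<close>

lemma trop_polynomial_add:
  assumes "trop_polynomial n A" "trop_polynomial n B"
  shows "trop_polynomial n (\<lambda>x. A x + B x)"
proof -
  obtain P where P: "finite P" "P \<noteq> {}" "snd ` P \<subseteq> ({..n} \<rightarrow>\<^sub>E \<rat>)"
      "\<And>x. x \<in> coord_space n \<Longrightarrow> A x = (MIN t\<in>P. fst t + inner_upto n (snd t) x)"
    using assms(1) unfolding trop_polynomial_def by blast
  obtain Q where Q: "finite Q" "Q \<noteq> {}" "snd ` Q \<subseteq> ({..n} \<rightarrow>\<^sub>E \<rat>)"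
      "\<And>x. x \<in> coord_space n \<Longrightarrow> B x = (MIN t\<in>Q. fst t + inner_upto n (snd t) x)"
    using assms(2) unfolding trop_polynomial_def by blast
  \<comment> \<open>Restricting the sum of the exponents makes it extensional again, so that it is
    an exponent vector.\<close>
  define m where "m = (\<lambda>(s, t). (fst s + fst t, \<lambda>i\<in>{..n}. snd s i + (snd t i :: real)) :: real \<times> (nat \<Rightarrow> real))"
  define R where "R = m ` (P \<times> Q)"
  have m: "fst (m (s, t)) + inner_upto n (snd (m (s, t))) x =
      (fst s + inner_upto n (snd s) x) + (fst t + inner_upto n (snd t) x)" for s t x
    by (simp add: m_def inner_upto_def sum.distrib algebra_simps)
  have "A x + B x = (MIN r\<in>R. fst r + inner_upto n (snd r) x)" if x: "x \<in> coord_space n" for x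
  proof -
    let ?f = "\<lambda>t. fst t + inner_upto n (snd t) x"
    have "Min (?f ` P) \<in> ?f ` P" "Min (?f ` Q) \<in> ?f ` Q"
      using P Q by (auto intro!: Min_in)
    then obtain s t where st: "s \<in> P" "t \<in> Q" "A x = ?f s" "B x = ?f t"
      using P(4)[OF x] Q(4)[OF x] by force
    have "(MIN r\<in>R. ?f r) = ?f s + ?f t"
    proof (rule Min_eqI)
      show "finite (?f ` R)" using P Q by (simp add: R_def)
      show "?f s + ?f t \<in> ?f ` R" unfolding R_def using st m[of s t x] by force
      fix y assume "y \<in> ?f ` R"
      then obtain s' t' where "s' \<in> P" "t' \<in> Q" "y = ?f s' + ?f t'"
        unfolding R_def using m by force
      moreover from this have "?f s \<le> ?f s'" "?f t \<le> ?f t'"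
        using P Q x st by (auto intro!: Min_le simp flip: st(3,4))
      ultimately show "?f s + ?f t \<le> y" by linarith
    qed
    then show ?thesis using st by simp
  qed
  moreover have "snd ` R \<subseteq> ({..n} \<rightarrow>\<^sub>E \<rat>)"
  proof
    fix I assume "I \<in> snd ` R"
    then obtain s t where st: "s \<in> P" "t \<in> Q" "I = (\<lambda>i\<in>{..n}. snd s i + snd t i)"
      by (auto simp: R_def m_def)
    have "snd s \<in> {..n} \<rightarrow>\<^sub>E \<rat>" "snd t \<in> {..n} \<rightarrow>\<^sub>E \<rat>"
      using P(3) Q(3) st(1,2) by blast+
    then show "I \<in> {..n} \<rightarrow>\<^sub>E \<rat>" by (auto simp: st(3) intro!: Rats_add)
  qed
  moreover have "finite R" "R \<noteq> {}" using P(1,2) Q(1,2) by (auto simp: R_def)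
  ultimately show ?thesis unfolding trop_polynomial_def by blast
qed

lemma trop_rational_inner:
  assumes "I \<in> {..n} \<rightarrow>\<^sub>E \<rat>"
  shows "trop_rational n (inner_upto n I)"
proof -
  have "trop_polynomial n (inner_upto n (\<lambda>i\<in>{..n}. 0))"
    by (rule trop_polynomial_inner) auto
  then show ?thesis
    unfolding trop_rational_def using trop_polynomial_inner[OF assms]
    by (intro exI[of _ "inner_upto n I"] exI[of _ "inner_upto n (\<lambda>i\<in>{..n}. 0)"])
      (auto simp: inner_upto_def)
qed

lemma trop_rational_uminus: "trop_rational n g \<Longrightarrow> trop_rational n (\<lambda>x. - g x)"
proof -
  assume "trop_rational n g"
  then obtain A B where "trop_polynomial n A" "trop_polynomial n B"
      "\<forall>x\<in>coord_space n. g x = A x - B x"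
    unfolding trop_rational_def by blast
  then show ?thesis
    unfolding trop_rational_def by (intro exI[of _ B] exI[of _ A]) simp
qed

text \<open>As with fractions, pass to a common subtrahend: \<open>A - B = (A + D) - (B + D)\<close>
  and \<open>C - D = (C + B) - (B + D)\<close>.\<close>

lemma trop_rational_min:
  assumes "trop_rational n f" "trop_rational n g"
  shows "trop_rational n (\<lambda>x. min (f x) (g x))"
proof -
  obtain A B where 1: "trop_polynomial n A" "trop_polynomial n B"
      "\<And>x. x \<in> coord_space n \<Longrightarrow> f x = A x - B x"
    using assms(1) unfolding trop_rational_def by blast
  obtain C D where 2: "trop_polynomial n C" "trop_polynomial n D"
      "\<And>x. x \<in> coord_space n \<Longrightarrow> g x = C x - D x"
    using assms(2) unfolding trop_rational_def by blast
  show ?thesis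
    unfolding trop_rational_def
  proof (intro exI conjI ballI)
    show "trop_polynomial n (\<lambda>x. min (A x + D x) (C x + B x))"
      by (intro trop_polynomial_min trop_polynomial_add 1 2)
    show "trop_polynomial n (\<lambda>x. B x + D x)"
      by (intro trop_polynomial_add 1 2)
    show "min (f x) (g x) = min (A x + D x) (C x + B x) - (B x + D x)"
      if "x \<in> coord_space n" for x
      using 1(3)[OF that] 2(3)[OF that] by (simp add: min_def)
  qed
qed

lemma trop_rational_Min:
  assumes "finite S" "S \<noteq> {}" "\<And>s. s \<in> S \<Longrightarrow> trop_rational n (f s)"
  shows "trop_rational n (\<lambda>x. MIN s\<in>S. f s x)"
  using assms
proof (induction S rule: finite_ne_induct)
  case (insert a S)
  then have "trop_rational n (\<lambda>x. min (f a x) (MIN s\<in>S. f s x))"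
    by (intro trop_rational_min) auto
  with insert show ?case by simp
qed simp

lemma trop_rational_Max:
  assumes "finite S" "S \<noteq> {}" "\<And>s. s \<in> S \<Longrightarrow> trop_rational n (f s)"
  shows "trop_rational n (\<lambda>x. MAX s\<in>S. f s x)"
proof -
  have "(\<lambda>x. MAX s\<in>S. f s x) = (\<lambda>x. - (MIN s\<in>S. - f s x))"
    using assms(1,2) by (simp add: minus_Min_eq_Max image_image)
  then show ?thesis
    using assms by (simp only:) (intro trop_rational_uminus trop_rational_Min; simp)
qed

text \<open>Among terms with the same exponent only the smallest coefficient can matter. This
  returns to the form in which the coefficient is a function of the exponent.\<close>

lemma trop_polynomial_canonical:
  assumes "trop_polynomial n A"
  shows "\<exists>\<I> a. finite \<I> \<and> \<I> \<noteq> {} \<and> \<I> \<subseteq> ({..n} \<rightarrow>\<^sub>E \<rat>) \<and>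
    (\<forall>x\<in>coord_space n. A x = (MIN I\<in>\<I>. a I + inner_upto n I x))"
proof -
  obtain P where P: "finite P" "P \<noteq> {}" "snd ` P \<subseteq> ({..n} \<rightarrow>\<^sub>E \<rat>)"
      "\<And>x. x \<in> coord_space n \<Longrightarrow> A x = (MIN t\<in>P. fst t + inner_upto n (snd t) x)"
    using assms unfolding trop_polynomial_def by blast
  define C where "C = (\<lambda>I. {c. (c, I) \<in> P})"
  have C: "finite (C I)" for I
    using finite_vimageI[OF P(1), of "\<lambda>c. (c, I)"] by (simp add: C_def vimage_def inj_def)
  have "A x = (MIN I\<in>snd ` P. Min (C I) + inner_upto n I x)" if "x \<in> coord_space n" for x
    unfolding P(4)[OF that]
  proof (rule antisym)
    show "(MIN t\<in>P. fst t + inner_upto n (snd t) x) \<le> (MIN I\<in>snd ` P. Min (C I) + inner_upto n I x)"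
    proof (intro Min.boundedI)
      fix v assume "v \<in> (\<lambda>I. Min (C I) + inner_upto n I x) ` snd ` P"
      then obtain c I where v: "(c, I) \<in> P" "v = Min (C I) + inner_upto n I x" by auto
      then have "Min (C I) \<in> C I" using C by (intro Min_in) (auto simp: C_def)
      then have "(Min (C I), I) \<in> P" by (simp add: C_def)
      then show "(MIN t\<in>P. fst t + inner_upto n (snd t) x) \<le> v"
        using P v by (intro Min_le) force+
    qed (use P in auto)
    show "(MIN I\<in>snd ` P. Min (C I) + inner_upto n I x) \<le> (MIN t\<in>P. fst t + inner_upto n (snd t) x)"
    proof (intro Min.boundedI)
      fix v assume "v \<in> (\<lambda>t. fst t + inner_upto n (snd t) x) ` P"
      then obtain c I where v: "(c, I) \<in> P" "v = c + inner_upto n I x" by auto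
      then have "Min (C I) \<le> c" using C by (intro Min_le) (auto simp: C_def)
      moreover have "(MIN I\<in>snd ` P. Min (C I) + inner_upto n I x) \<le> Min (C I) + inner_upto n I x"
        using P v by (intro Min_le) force+
      ultimately show "(MIN I\<in>snd ` P. Min (C I) + inner_upto n I x) \<le> v"
        using v by linarith
    qed (use P in auto)
  qed
  with P show ?thesis
    by (intro exI[of _ "snd ` P"] exI[of _ "\<lambda>I. Min (C I)"]) auto
qed

lemma trop_newton_puiseux_restrict:
  assumes "trop_rational n g"
  shows "trop_newton_puiseux n (restrict g (coord_space n))"
proof -
  obtain A B where AB: "trop_polynomial n A" "trop_polynomial n B"
      "\<And>x. x \<in> coord_space n \<Longrightarrow> g x = A x - B x"
    using assms unfolding trop_rational_def by blast
  from trop_polynomial_canonical[OF AB(1)] obtain \<I> a where I: "finite \<I>" "\<I> \<noteq> {}"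
      "\<I> \<subseteq> ({..n} \<rightarrow>\<^sub>E \<rat>)" "\<forall>x\<in>coord_space n. A x = (MIN I\<in>\<I>. a I + inner_upto n I x)"
    by blast
  from trop_polynomial_canonical[OF AB(2)] obtain \<J> b where J: "finite \<J>" "\<J> \<noteq> {}"
      "\<J> \<subseteq> ({..n} \<rightarrow>\<^sub>E \<rat>)" "\<forall>x\<in>coord_space n. B x = (MIN J\<in>\<J>. b J + inner_upto n J x)"
    by blast
  show ?thesis
    unfolding trop_newton_puiseux_def
    by (intro conjI exI[of _ \<I>] exI[of _ \<J>] exI[of _ a] exI[of _ b])
      (simp_all add: I J AB(3))
qed

lemma trop_rational_slope:
  assumes "p \<le> n" "q \<le> n" "p \<noteq> q"
  shows "trop_rational n (\<lambda>x. (x p - x q) / (real q - real p))"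
proof -
  define I where "I = (\<lambda>i\<in>{..n}. if i = p then 1 / (real q - real p)
    else if i = q then - 1 / (real q - real p) else 0)"
  have "I \<in> {..n} \<rightarrow>\<^sub>E \<rat>"
    by (auto simp: I_def intro!: Rats_divide Rats_diff)
  moreover have "inner_upto n I x = (x p - x q) / (real q - real p)" for x
  proof -
    have "inner_upto n I x = (\<Sum>i\<in>{p, q}. I i * x i)"
      unfolding inner_upto_def by (rule sum.mono_neutral_right) (use assms in \<open>auto simp: I_def\<close>)
    also have "\<dots> = (x p - x q) / (real q - real p)"
      using assms by (simp add: I_def diff_divide_distrib)
    finally show ?thesis .
  qed
  then have "inner_upto n I = (\<lambda>x. (x p - x q) / (real q - real p))" by (rule ext)
  ultimately show ?thesis using trop_rational_inner[of I n] by simp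
qed

section \<open>The zeroes of a tropical polynomial\<close>

text \<open>The claimed formula for the zero, left unrestricted so that pointwise facts need no
  membership in \<open>coord_space n\<close>.\<close>

definition kth_zero :: "nat \<Rightarrow> nat \<Rightarrow> (nat \<Rightarrow> real) \<Rightarrow> real" where
  "kth_zero n k x = (MIN p\<in>{..<k}. MAX q\<in>{k..n}. (x p - x q) / (real q - real p))"

lemma trop_poly_le: "j \<le> n \<Longrightarrow> trop_poly n x y \<le> x j + real j * y"
  unfolding trop_poly_def by (intro Min_le) auto

lemma trop_poly_geI: "(\<And>j. j \<le> n \<Longrightarrow> c \<le> x j + real j * y) \<Longrightarrow> c \<le> trop_poly n x y"
  unfolding trop_poly_def by (intro Min.boundedI) auto

text \<open>Sharpens the zero condition by an index separating two minimizing terms. For fixed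
  \<open>k\<close> this determines \<open>y\<close>, which being a tropical zero alone does
  not.\<close>

definition splits_at :: "nat \<Rightarrow> (nat \<Rightarrow> real) \<Rightarrow> nat \<Rightarrow> real \<Rightarrow> bool" where
  "splits_at n x k y \<longleftrightarrow> (\<exists>p<k. \<exists>q\<in>{k..n}.
     x p + real p * y = trop_poly n x y \<and> x q + real q * y = trop_poly n x y)"

lemma is_trop_zero_iff: "is_trop_zero n x y \<longleftrightarrow> (\<exists>k\<in>{1..n}. splits_at n x k y)"
proof
  assume "is_trop_zero n x y"
  then obtain j k where jk: "j \<le> n" "k \<le> n" "j \<noteq> k"
      "x j + real j * y = trop_poly n x y" "x k + real k * y = trop_poly n x y"
    unfolding is_trop_zero_def by blast
  then show "\<exists>k\<in>{1..n}. splits_at n x k y"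
    unfolding splits_at_def
    \<comment> \<open>The larger index serves both as the separating index and as the upper
      minimizer; it is at least 1 because the two differ.\<close>
    by (intro bexI[of _ "max j k"] exI[of _ "min j k"]) (auto simp: min_def max_def)
next
  assume "\<exists>k\<in>{1..n}. splits_at n x k y"
  then obtain k p q where "p < k" "k \<le> q" "q \<le> n"
      "x p + real p * y = trop_poly n x y" "x q + real q * y = trop_poly n x y"
    unfolding splits_at_def by auto
  then show "is_trop_zero n x y"
    unfolding is_trop_zero_def by (intro exI[of _ p] exI[of _ q] conjI) auto
qed

text \<open>The quotient is where the lines \<open>a + p Y\<close> and \<open>b + q Y\<close> cross;
  the second is steeper, hence the upper one to the right of the crossing.\<close>

lemma slope_le_iff:
  assumes "p < (q :: nat)"
  shows "(a - b) / (real q - real p) \<le> y \<longleftrightarrow> a + real p * y \<le> b + real q * y"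
    and "y \<le> (a - b) / (real q - real p) \<longleftrightarrow> b + real q * y \<le> a + real p * y"
  using assms by (simp_all add: pos_divide_le_eq pos_le_divide_eq algebra_simps)

text \<open>By \<open>slope_le_iff\<close>, \<open>t p\<close> is the least \<open>y\<close> at
  which line \<open>p\<close> is below all lines with index at least \<open>k\<close>, and there it
  meets one of them. For the \<open>p\<close> minimizing \<open>t\<close>, any other
  \<open>p' < k\<close> has \<open>y \<le> t p'\<close>, so line \<open>p'\<close> is still above
  some line with index at least \<open>k\<close>, and thus above line \<open>p\<close>.\<close>

lemma splits_at_kth_zero:
  assumes "k \<in> {1..n}"
  shows "splits_at n x k (kth_zero n k x)"
proof -
  define t where "t = (\<lambda>p. MAX q\<in>{k..n}. (x p - x q) / (real q - real p))"
  define y where "y = kth_zero n k x"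
  have "y = Min (t ` {..<k})" by (simp add: y_def kth_zero_def t_def)
  moreover have "Min (t ` {..<k}) \<in> t ` {..<k}" using assms by (intro Min_in) (auto simp: lessThan_empty_iff)
  ultimately obtain p where p: "p < k" "y = t p" by auto
  have t_in: "\<exists>q\<in>{k..n}. t p' = (x p' - x q) / (real q - real p')" for p'
  proof -
    have "t p' \<in> (\<lambda>q. (x p' - x q) / (real q - real p')) ` {k..n}"
      unfolding t_def using assms by (intro Max_in) auto
    then show ?thesis by auto
  qed
  from t_in[of p] obtain q where q: "q \<in> {k..n}" "t p = (x p - x q) / (real q - real p)" by auto
  have pq: "x p + real p * y = x q + real q * y"
  proof -
    have "p < q" "(x p - x q) / (real q - real p) = y" using p q by auto
    then show ?thesis using slope_le_iff[of p q, where a = "x p" and b = "x q" and y = y]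
      by (metis antisym order_refl)
  qed
  have right: "x p + real p * y \<le> x q' + real q' * y" if "q' \<in> {k..n}" for q'
  proof -
    have "(x p - x q') / (real q' - real p) \<le> y"
      unfolding p(2) t_def using that by (intro Max_ge) auto
    then show ?thesis using slope_le_iff(1)[of p q'] p(1) that by simp
  qed
  have left: "x p + real p * y \<le> x p' + real p' * y" if "p' < k" for p'
  proof -
    obtain q' where q': "q' \<in> {k..n}" "t p' = (x p' - x q') / (real q' - real p')"
      using t_in by blast
    have "y \<le> t p'" unfolding \<open>y = Min _\<close> using that by (intro Min_le) auto
    then have "x q' + real q' * y \<le> x p' + real p' * y"
      using slope_le_iff(2)[of p' q'] q' that by simp
    with right[OF q'(1)] show ?thesis by linarith
  qed
  have "x p + real p * y \<le> trop_poly n x y"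
  proof (rule trop_poly_geI)
    show "x p + real p * y \<le> x j + real j * y" if "j \<le> n" for j
      using left[of j] right[of j] that by (cases "j < k") auto
  qed
  moreover have "trop_poly n x y \<le> x p + real p * y"
    using p assms by (intro trop_poly_le) auto
  ultimately show ?thesis
    unfolding splits_at_def y_def[symmetric] using p(1) q(1) pq
    by (intro exI[of _ p] bexI[of _ q] conjI) auto
qed

text \<open>If \<open>p < k \<le> q\<close> are minimizers at \<open>y\<close>, minimality of line
  \<open>q\<close> gives \<open>y \<le> t p'\<close> for every \<open>p' < k\<close>, and minimality
  of line \<open>p\<close> gives \<open>t p \<le> y\<close>. So \<open>y\<close> is the minimum of
  \<open>t\<close>, attained at \<open>p\<close>.\<close>

lemma kth_zero_unique:
  assumes "splits_at n x k y"
  shows "y = kth_zero n k x"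
proof -
  define t where "t = (\<lambda>p. MAX q\<in>{k..n}. (x p - x q) / (real q - real p))"
  obtain p q where pq: "p < k" "k \<le> q" "q \<le> n"
      "x p + real p * y = trop_poly n x y" "x q + real q * y = trop_poly n x y"
    using assms unfolding splits_at_def by auto
  have "y \<le> t p'" if "p' < k" for p'
  proof -
    have "x q + real q * y \<le> x p' + real p' * y"
      using trop_poly_le[of p' n x y] that pq by simp
    then have "y \<le> (x p' - x q) / (real q - real p')"
      using slope_le_iff(2)[of p' q] that pq by simp
    also have "\<dots> \<le> t p'" unfolding t_def using pq by (intro Max_ge) auto
    finally show ?thesis .
  qed
  moreover have "t p \<le> y"
    unfolding t_def
  proof (intro Max.boundedI)
    fix v assume "v \<in> (\<lambda>q. (x p - x q) / (real q - real p)) ` {k..n}"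
    then obtain q' where "q' \<in> {k..n}" "v = (x p - x q') / (real q' - real p)" by auto
    then show "v \<le> y"
      using slope_le_iff(1)[of p q' "x p" "x q'" y] trop_poly_le[of q' n x y] pq by auto
  qed (use pq in auto)
  ultimately have "t p = y" "\<And>p'. p' < k \<Longrightarrow> y \<le> t p'" using pq(1) by (auto intro: antisym)
  then have "Min (t ` {..<k}) = y"
    using pq(1) by (intro Min_eqI) auto
  then show ?thesis by (simp add: kth_zero_def t_def)
qed

lemma is_trop_zero_iff_kth_zero: "is_trop_zero n x y \<longleftrightarrow> (\<exists>k\<in>{1..n}. y = kth_zero n k x)"
  unfolding is_trop_zero_iff using kth_zero_unique splits_at_kth_zero by blast

section \<open>Distinctness of the zeroes at strictly convex points\<close>

definition strictly_convex_upto :: "nat \<Rightarrow> (nat \<Rightarrow> real) \<Rightarrow> bool" where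
  "strictly_convex_upto n z \<longleftrightarrow> (\<forall>p j q. p < j \<longrightarrow> j < q \<longrightarrow> q \<le> n \<longrightarrow>
     (real q - real p) * z j < (real q - real j) * z p + (real j - real p) * z q)"

text \<open>A common value \<open>y\<close> would have minimizers \<open>p < k\<close> and
  \<open>q \<ge> l > k\<close>. Strict convexity then pushes the term at \<open>k\<close>, strictly
  between them, below the minimum.\<close>

lemma kth_zero_strictly_convex_neq:
  assumes z: "strictly_convex_upto n z" and kl: "k \<in> {1..n}" "l \<in> {1..n}" "k < l"
  shows "kth_zero n k z \<noteq> kth_zero n l z"
proof
  assume eq: "kth_zero n k z = kth_zero n l z"
  define y where "y = kth_zero n k z"
  obtain p where p: "p < k" "z p + real p * y = trop_poly n z y"
    using splits_at_kth_zero[OF kl(1), of z] unfolding splits_at_def y_def by auto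
  obtain q where q: "l \<le> q" "q \<le> n" "z q + real q * y = trop_poly n z y"
    using splits_at_kth_zero[OF kl(2), of z] unfolding splits_at_def y_def eq by auto
  define c where "c = trop_poly n z y"
  have "(real q - real p) * z k < (real q - real k) * z p + (real k - real p) * z q"
    using z p q kl unfolding strictly_convex_upto_def by auto
  also have "z p = c - real p * y" using p by (simp add: c_def)
  also have "z q = c - real q * y" using q by (simp add: c_def)
  finally have "(real q - real p) * (z k + real k * y) < (real q - real p) * c"
    by (simp add: algebra_simps)
  then have "z k + real k * y < c"
    using p q kl by (simp add: mult_less_cancel_left_pos)
  with trop_poly_le[of k n z y] kl show False by (simp add: c_def)
qed

lemma kth_zero_strictly_convex_inj:
  assumes "strictly_convex_upto n z"
  shows "inj_on (\<lambda>k. kth_zero n k z) {1..n}"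
  by (rule linorder_inj_onI) (use kth_zero_strictly_convex_neq[OF assms] in auto)

section \<open>Continuous selections of zeroes\<close>

definition segment :: "nat \<Rightarrow> (nat \<Rightarrow> real) \<Rightarrow> (nat \<Rightarrow> real) \<Rightarrow> real \<Rightarrow> nat \<Rightarrow> real" where
  "segment n u v s = (\<lambda>i\<in>{..n}. (1 - s) * u i + s * v i)"

lemma segment_in_coord_space [simp]: "segment n u v s \<in> coord_space n"
  by (simp add: segment_def coord_space_def)

lemma segment_0: "u \<in> coord_space n \<Longrightarrow> segment n u v 0 = u"
  and segment_1: "v \<in> coord_space n \<Longrightarrow> segment n u v 1 = v"
  by (auto simp: segment_def coord_space_def PiE_def extensional_def fun_eq_iff)

lemma continuous_on_MIN:
  fixes f :: "'a \<Rightarrow> 'b::topological_space \<Rightarrow> real"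
  assumes "finite S" "S \<noteq> {}" "\<And>s. s \<in> S \<Longrightarrow> continuous_on T (f s)"
  shows "continuous_on T (\<lambda>x. MIN s\<in>S. f s x)"
  using assms
proof (induction S rule: finite_ne_induct)
  case (insert a S)
  then have "continuous_on T (\<lambda>x. min (f a x) (MIN s\<in>S. f s x))"
    by (intro continuous_on_min) auto
  with insert show ?case by simp
qed simp

lemma trop_newton_puiseux_continuous_segment:
  assumes "trop_newton_puiseux n g"
  shows "continuous_on T (\<lambda>s. g (segment n u v s))"
proof -
  obtain \<I> \<J> a b where *: "finite \<I>" "\<I> \<noteq> {}" "finite \<J>" "\<J> \<noteq> {}"
      "\<And>x. x \<in> coord_space n \<Longrightarrow>
        g x = (MIN I\<in>\<I>. a I + inner_upto n I x) - (MIN J\<in>\<J>. b J + inner_upto n J x)"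
    using assms unfolding trop_newton_puiseux_def by (elim conjE exE) simp
  have inner: "continuous_on T (\<lambda>s. inner_upto n I (segment n u v s))" for I
    unfolding inner_upto_def segment_def by (simp, intro continuous_intros)
  show ?thesis
    unfolding *(5)[OF segment_in_coord_space] using *(1-4)
    by (intro continuous_on_diff continuous_on_MIN continuous_on_add continuous_on_const inner)
qed

text \<open>By \<open>sep\<close>, two branches agree everywhere on \<open>T\<close> or nowhere. So
  the set where \<open>h\<close> follows branch \<open>k\<close> is closed, and its complement is
  the finite union of the closed sets belonging to the branches that differ from \<open>k\<close>;
  connectedness finishes. The hypothesis \<open>sep\<close> covers both branches that stay distinct
  and branches that are constant.\<close>

lemma continuous_selection_unique:
  fixes h :: "'b::topological_space \<Rightarrow> real" and l :: "'a \<Rightarrow> 'b \<Rightarrow> real"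
  assumes "connected T" "finite K" "continuous_on T h"
    and cont: "\<And>k. k \<in> K \<Longrightarrow> continuous_on T (l k)"
    and sel: "\<And>s. s \<in> T \<Longrightarrow> \<exists>k\<in>K. h s = l k s"
    and sep: "\<And>j k r s. j \<in> K \<Longrightarrow> k \<in> K \<Longrightarrow> r \<in> T \<Longrightarrow> s \<in> T \<Longrightarrow> l j r = l k r \<Longrightarrow> l j s = l k s"
    and k: "k \<in> K" "r \<in> T" "h r = l k r" and "s \<in> T"
  shows "h s = l k s"
proof -
  define E where "E = (\<lambda>j. {s \<in> T. h s = l j s})"
  have closed: "closedin (top_of_set T) (E j)" if "j \<in> K" for j
  proof -
    have "closedin (top_of_set T) {s \<in> T. h s - l j s = 0}"
      using assms(3) cont[OF that] by (intro continuous_closedin_preimage_constant continuous_intros)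
    then show ?thesis by (simp add: E_def)
  qed
  define N where "N = {j \<in> K. l j r \<noteq> l k r}"
  have "T - E k = (\<Union>j\<in>N. E j)"
  proof (intro set_eqI iffI)
    fix t assume t: "t \<in> T - E k"
    then obtain j where j: "j \<in> K" "h t = l j t" using sel by blast
    then have "l j r \<noteq> l k r" using sep[of j k r t] t k by (auto simp: E_def)
    with j t show "t \<in> (\<Union>j\<in>N. E j)" by (auto simp: N_def E_def)
  next
    fix t assume "t \<in> (\<Union>j\<in>N. E j)"
    then obtain j where "j \<in> K" "l j r \<noteq> l k r" "t \<in> T" "h t = l j t"
      by (auto simp: N_def E_def)
    then show "t \<in> T - E k" using sep[of j k t r] k by (auto simp: E_def)
  qed
  moreover have "closedin (top_of_set T) (\<Union>j\<in>N. E j)"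
    using assms(2) closed by (intro closedin_Union) (auto simp: N_def)
  ultimately have "openin (top_of_set T) (E k)"
    by (simp add: openin_closedin_eq E_def subset_eq)
  with closed[OF k(1)] have "E k = {} \<or> E k = T"
    using assms(1) connected_clopen by blast
  then show ?thesis using k \<open>s \<in> T\<close> by (auto simp: E_def)
qed

text \<open>The lower convex hull of the points \<open>(j, x j)\<close>, whose edges have slopes \<open>- kth_zero n k x\<close>.\<close>

definition lower_hull :: "nat \<Rightarrow> (nat \<Rightarrow> real) \<Rightarrow> nat \<Rightarrow> real" where
  "lower_hull n x = (\<lambda>j\<in>{..n}. MAX k\<in>{1..n}. trop_poly n x (kth_zero n k x) - real j * kth_zero n k x)"

lemma lower_hull_in_coord_space [simp]: "lower_hull n x \<in> coord_space n"
  by (simp add: lower_hull_def coord_space_def)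

lemma lower_hull_ge:
  assumes "k \<in> {1..n}" "j \<le> n"
  shows "trop_poly n x (kth_zero n k x) \<le> lower_hull n x j + real j * kth_zero n k x"
proof -
  have "trop_poly n x (kth_zero n k x) - real j * kth_zero n k x \<le> lower_hull n x j"
    using assms by (auto simp: lower_hull_def intro!: Max_ge)
  then show ?thesis by simp
qed

lemma lower_hull_attained:
  assumes "n \<ge> 1" "j \<le> n"
  obtains k where "k \<in> {1..n}"
    "lower_hull n x j = trop_poly n x (kth_zero n k x) - real j * kth_zero n k x"
proof -
  have "lower_hull n x j \<in> (\<lambda>k. trop_poly n x (kth_zero n k x) - real j * kth_zero n k x) ` {1..n}"
    using assms unfolding lower_hull_def by simp
  with that show ?thesis by auto
qed

lemma lower_hull_le:
  assumes "n \<ge> 1" "j \<le> n"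
  shows "lower_hull n x j \<le> x j"
proof -
  obtain k where "lower_hull n x j = trop_poly n x (kth_zero n k x) - real j * kth_zero n k x"
    using lower_hull_attained[OF assms, of x] by metis
  with trop_poly_le[OF assms(2), of x "kth_zero n k x"] show ?thesis by simp
qed

text \<open>A maximum of affine functions is convex: the affine function attaining the maximum at
  \<open>j\<close> bounds the hull from below at \<open>p\<close> and \<open>q\<close>.\<close>

lemma lower_hull_convex:
  assumes "n \<ge> 1" "p < j" "j < q" "q \<le> n"
  shows "(real q - real p) * lower_hull n x j \<le>
    (real q - real j) * lower_hull n x p + (real j - real p) * lower_hull n x q"
proof -
  obtain k where k: "k \<in> {1..n}"
      "lower_hull n x j = trop_poly n x (kth_zero n k x) - real j * kth_zero n k x"
    using lower_hull_attained[of n j x] assms by auto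
  define y c where "y = kth_zero n k x" and "c = trop_poly n x y"
  have "c - real p * y \<le> lower_hull n x p" "c - real q * y \<le> lower_hull n x q"
    using lower_hull_ge[OF k(1), of p x] lower_hull_ge[OF k(1), of q x] assms
    by (auto simp: c_def y_def)
  then have "(real q - real j) * (c - real p * y) + (real j - real p) * (c - real q * y) \<le>
      (real q - real j) * lower_hull n x p + (real j - real p) * lower_hull n x q"
    using assms by (intro add_mono mult_left_mono) auto
  then show ?thesis
    unfolding k(2) y_def[symmetric] c_def[symmetric] by (simp add: algebra_simps)
qed

text \<open>At \<open>y\<close>, staying above the hull keeps the minimum from dropping, and staying
  below \<open>x\<close> keeps it from rising at the two minimizers of \<open>x\<close>. So the same
  indices split \<open>w\<close> at \<open>k\<close>, and uniqueness applies.\<close>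

lemma kth_zero_between_hull:
  assumes "k \<in> {1..n}" "\<And>j. j \<le> n \<Longrightarrow> lower_hull n x j \<le> w j" "\<And>j. j \<le> n \<Longrightarrow> w j \<le> x j"
  shows "kth_zero n k w = kth_zero n k x"
proof -
  define y where "y = kth_zero n k x"
  obtain p q where pq: "p < k" "k \<le> q" "q \<le> n"
      "x p + real p * y = trop_poly n x y" "x q + real q * y = trop_poly n x y"
    using splits_at_kth_zero[OF assms(1), of x] unfolding splits_at_def y_def by auto
  have ge: "trop_poly n x y \<le> trop_poly n w y"
  proof (rule trop_poly_geI)
    fix j assume "j \<le> n"
    with lower_hull_ge[OF assms(1), of j x] assms(2)[of j]
    show "trop_poly n x y \<le> w j + real j * y" by (simp add: y_def)
  qed
  have "w p + real p * y = trop_poly n w y" "w q + real q * y = trop_poly n w y"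
    using ge pq assms(3)[of p] assms(3)[of q] trop_poly_le[of p n w y] trop_poly_le[of q n w y]
    by auto
  then have "splits_at n w k y"
    unfolding splits_at_def using pq by (intro exI[of _ p] bexI[of _ q] conjI) auto
  from kth_zero_unique[OF this] show ?thesis by (simp add: y_def)
qed

text \<open>A strictly convex base point: the value of a parametric zero here identifies its
  index.\<close>

definition squares :: "nat \<Rightarrow> nat \<Rightarrow> real" where
  "squares n = (\<lambda>j\<in>{..n}. (real j)\<^sup>2)"

lemma squares_in_coord_space [simp]: "squares n \<in> coord_space n"
  by (simp add: squares_def coord_space_def)

lemma squares_strict:
  assumes "p < j" "j < q" "q \<le> n"
  shows "(real q - real p) * squares n j <
    (real q - real j) * squares n p + (real j - real p) * squares n q"
proof -
  \<comment> \<open>This product is exactly the difference of the two sides.\<close>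
  have "0 < (real q - real p) * (real q - real j) * (real j - real p)"
    using assms by simp
  then show ?thesis
    using assms by (simp add: squares_def power2_eq_square algebra_simps)
qed

text \<open>Convex plus a positive multiple of strictly convex. The end \<open>s = 0\<close> is
  excluded because the hull may have collinear points.\<close>

lemma segment_hull_squares_strictly_convex:
  assumes "n \<ge> 1" "0 < s" "s \<le> 1"
  shows "strictly_convex_upto n (segment n (lower_hull n x) (squares n) s)"
  unfolding strictly_convex_upto_def
proof (intro allI impI)
  fix p j q assume pjq: "p < j" "j < q" "q \<le> n"
  let ?u = "lower_hull n x" and ?v = "squares n"
  have "(1 - s) * ((real q - real p) * ?u j) \<le>
      (1 - s) * ((real q - real j) * ?u p + (real j - real p) * ?u q)"
    using lower_hull_convex[OF assms(1) pjq] assms by (intro mult_left_mono) auto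
  moreover have "s * ((real q - real p) * ?v j) <
      s * ((real q - real j) * ?v p + (real j - real p) * ?v q)"
    using squares_strict[OF pjq] assms by (intro mult_strict_left_mono) auto
  ultimately show "(real q - real p) * segment n ?u ?v s j <
      (real q - real j) * segment n ?u ?v s p + (real j - real p) * segment n ?u ?v s q"
    using pjq by (simp add: segment_def algebra_simps)
qed

section \<open>The zeroes as Newton-Puiseux polynomials, and their number\<close>

lemma zero_term_trop_newton_puiseux:
  assumes "k \<in> {1..n}" "p < k"
  shows "trop_newton_puiseux n (zero_term n k p)"
  unfolding zero_term_def using assms
  by (intro trop_newton_puiseux_restrict trop_rational_Max trop_rational_slope) auto

lemma kth_zero_trop_newton_puiseux:
  assumes "k \<in> {1..n}"
  shows "trop_newton_puiseux n (restrict (kth_zero n k) (coord_space n))"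
proof -
  have "trop_rational n (\<lambda>x. MIN p\<in>{..<k}. MAX q\<in>{k..n}. (x p - x q) / (real q - real p))"
    using assms by (intro trop_rational_Min trop_rational_Max trop_rational_slope)
      (auto simp: lessThan_empty_iff)
  then show ?thesis
    by (intro trop_newton_puiseux_restrict) (simp add: kth_zero_def[abs_def])
qed

lemma kth_zero_continuous_segment:
  assumes "k \<in> {1..n}"
  shows "continuous_on T (\<lambda>s. kth_zero n k (segment n u v s))"
  using trop_newton_puiseux_continuous_segment[OF kth_zero_trop_newton_puiseux[OF assms], of T u v]
  by simp

lemma parametric_zero_eq_kth_zero:
  assumes n: "n \<ge> 1" and g: "g \<in> parametric_zeroes n" and k: "k \<in> {1..n}"
    and base: "g (squares n) = kth_zero n k (squares n)" and x: "x \<in> coord_space n"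
  shows "g x = kth_zero n k x"
proof -
  let ?u = "lower_hull n x" and ?v = "squares n"
  have cont: "continuous_on T (\<lambda>s. g (segment n a b s))" for T a b
    using g by (intro trop_newton_puiseux_continuous_segment) (simp add: parametric_zeroes_def)
  have sel: "\<exists>j\<in>{1..n}. g (segment n a b s) = kth_zero n j (segment n a b s)" for a b s
    using g by (simp add: parametric_zeroes_def is_trop_zero_iff_kth_zero)
  \<comment> \<open>The interval is half-open, since at the hull several zeroes may coincide. The
    index is known at \<open>s = 1\<close>, the base point.\<close>
  have "g (segment n ?u ?v s) = kth_zero n k (segment n ?u ?v s)" if "s \<in> {0<..1}" for s
  proof (rule continuous_selection_unique[where T = "{0<..1}" and K = "{1..n}" and r = 1
        and h = "\<lambda>s. g (segment n ?u ?v s)" and l = "\<lambda>k s. kth_zero n k (segment n ?u ?v s)"])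
    fix i j r t
    assume "i \<in> {1..n}" "j \<in> {1..n}" "r \<in> {0<..1::real}"
      "kth_zero n i (segment n ?u ?v r) = kth_zero n j (segment n ?u ?v r)"
    then have "i = j"
      using kth_zero_strictly_convex_inj[OF segment_hull_squares_strictly_convex[OF n, of r x]]
      by (auto dest: inj_onD)
    then show "kth_zero n i (segment n ?u ?v t) = kth_zero n j (segment n ?u ?v t)" by simp
  qed (use that k base in \<open>auto simp: cont sel[simplified] segment_1 kth_zero_continuous_segment connected_Ioc\<close>)
  \<comment> \<open>Continuity carries the equality to the missing endpoint 0, which lies in the
    closure of \<open>{0<..1}\<close>.\<close>
  then have "g (segment n ?u ?v 0) - kth_zero n k (segment n ?u ?v 0) = 0"
    using k by (intro continuous_constant_on_closure[of "{0<..1}"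
        "\<lambda>s. g (segment n ?u ?v s) - kth_zero n k (segment n ?u ?v s)" 0 0]
        continuous_on_diff cont kth_zero_continuous_segment) simp_all
  then have hull: "g ?u = kth_zero n k ?u" by (simp add: segment_0)
  \<comment> \<open>The second segment stays between the hull and \<open>x\<close>, so two zeroes
    that agree at one of its points agree at all of them, as \<open>sep\<close> requires.\<close>
  have const: "kth_zero n j (segment n ?u x s) = kth_zero n j x" if "s \<in> {0..1}" "j \<in> {1..n}" for s j
  proof (rule kth_zero_between_hull[OF that(2)])
    fix i assume "i \<le> n"
    then have "?u i \<le> x i" using lower_hull_le n by blast
    then have "(1 - s) * ?u i \<le> (1 - s) * x i" "s * ?u i \<le> s * x i"
      using that(1) by (auto intro!: mult_left_mono)
    with \<open>i \<le> n\<close> show "?u i \<le> segment n ?u x s i" "segment n ?u x s i \<le> x i"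
      by (auto simp: segment_def algebra_simps)
  qed
  have "g (segment n ?u x 1) = kth_zero n k (segment n ?u x 1)"
  proof (rule continuous_selection_unique[where T = "{0..1}" and K = "{1..n}" and r = 0
        and h = "\<lambda>s. g (segment n ?u x s)" and l = "\<lambda>k s. kth_zero n k (segment n ?u x s)"])
    fix i j r t
    assume "i \<in> {1..n}" "j \<in> {1..n}" "r \<in> {0..1::real}" "t \<in> {0..1::real}"
      "kth_zero n i (segment n ?u x r) = kth_zero n j (segment n ?u x r)"
    then show "kth_zero n i (segment n ?u x t) = kth_zero n j (segment n ?u x t)"
      using const by metis
  qed (use k hull in \<open>auto simp: cont sel[simplified] segment_0 kth_zero_continuous_segment\<close>)
  with x show ?thesis by (simp add: segment_1)
qed

theorem theorem2p1:
  fixes n :: nat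
  assumes "n \<ge> 1"
  shows "finite (parametric_zeroes n) \<and> card (parametric_zeroes n) = n \<and>
    (\<forall>k\<in>{1..n}. \<forall>p<k. trop_newton_puiseux n (zero_term n k p)) \<and>
    (\<exists>g. bij_betw g {1..n} (parametric_zeroes n) \<and>
         (\<forall>k\<in>{1..n}. \<forall>x\<in>coord_space n. g k x = (MIN p\<in>{..<k}. zero_term n k p x)))"
proof -
  define g where "g = (\<lambda>k. restrict (kth_zero n k) (coord_space n))"
  have "strictly_convex_upto n (squares n)"
    using squares_strict unfolding strictly_convex_upto_def by blast
  then have inj: "inj_on (\<lambda>k. kth_zero n k (squares n)) {1..n}"
    by (rule kth_zero_strictly_convex_inj)
  have bij: "bij_betw g {1..n} (parametric_zeroes n)"
    unfolding bij_betw_def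
  proof
    show "inj_on g {1..n}"
    proof (rule inj_onI)
      \<comment> \<open>Evaluation at the base point already separates the functions.\<close>
      fix i j assume ij: "i \<in> {1..n}" "j \<in> {1..n}" "g i = g j"
      from fun_cong[OF ij(3), of "squares n"]
      have "kth_zero n i (squares n) = kth_zero n j (squares n)" by (simp add: g_def)
      with inj ij show "i = j" by (auto dest: inj_onD)
    qed
    show "g ` {1..n} = parametric_zeroes n"
    proof
      show "g ` {1..n} \<subseteq> parametric_zeroes n"
        using kth_zero_trop_newton_puiseux
        by (force simp: g_def parametric_zeroes_def is_trop_zero_iff_kth_zero)
      show "parametric_zeroes n \<subseteq> g ` {1..n}"
      proof
        fix h assume h: "h \<in> parametric_zeroes n"
        then have "is_trop_zero n (squares n) (h (squares n))"
          by (simp add: parametric_zeroes_def)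
        then obtain k where k: "k \<in> {1..n}" "h (squares n) = kth_zero n k (squares n)"
          unfolding is_trop_zero_iff_kth_zero by blast
        \<comment> \<open>Both functions are extensional, so agreement on the space makes them equal
          as HOL functions.\<close>
        have "h \<in> extensional (coord_space n)"
          using h by (simp add: parametric_zeroes_def trop_newton_puiseux_def PiE_def)
        moreover have "h x = g k x" if "x \<in> coord_space n" for x
          using parametric_zero_eq_kth_zero[OF assms h k that] that by (simp add: g_def)
        ultimately have "h = g k"
          by (intro extensionalityI[of _ "coord_space n"]) (auto simp: g_def)
        with k show "h \<in> g ` {1..n}" by blast
      qed
    qed
  qed
  moreover have "g k x = (MIN p\<in>{..<k}. zero_term n k p x)" if "x \<in> coord_space n" for k x
    using that by (simp add: g_def kth_zero_def zero_term_def)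
  ultimately show ?thesis
    using zero_term_trop_newton_puiseux bij_betw_finite[OF bij] bij_betw_same_card[OF bij] by auto
qed

end
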